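(* Let $S$ be a right coherent monoid and let $J$ be a monoid $\mathcal{J}$-class of $S$. Then $J$ is right coherent.
   Context: Green's relation $\mathcal{J}$ on a monoid $S$ is defined by $a\,\mathcal{J}\,b$ if and only if $SaS=SbS$. A monoid $\mathcal{J}$-class is a $\mathcal{J}$-class $J$ that is a subsemigroup of $S$ and has an identity element $e\in J$ (not necessarily the identity of $S$); it is then regarded as a monoid in its own right. A right $S$-act is a set $A$ with a map $A\times S\to A$, $(a,s)\mapsto as$, with $a1=a$ and $a(st)=(as)t$. The free right $S$-act on a set $X$ is $F_S(X)=X\times S$ with $(x,s)t=(x,st)$. A congruence on a right $S$-act is an equivalence relation preserved by the action; it is finitely generated if it is the smallest congruence containing some finite set of pairs. An act $A$ is finitely generated if $A=a_1S\cup\dots\cup a_nS$ for some $a_i\in A$, and finitely presented if it is isomorphic to $F_S(X)/\rho$ with $X$ finite and $\rho$ a finitely generated congruence. The empty set is allowed as a subact (and is finitely generated). The monoid $S$ is right coherent if every finitely generated subact of every finitely presented right $S$-act is finitely presented. *)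

theory Defs
  imports "HOL-Algebra.Group"
begin

section \<open>Green's relation J\<close>

definition principal_ideal :: "('s, 'm) monoid_scheme \<Rightarrow> 's \<Rightarrow> 's set" where
  "principal_ideal S a = {s \<otimes>\<^bsub>S\<^esub> a \<otimes>\<^bsub>S\<^esub> t | s t. s \<in> carrier S \<and> t \<in> carrier S}"

definition green_J :: "('s, 'm) monoid_scheme \<Rightarrow> 's rel" where
  "green_J S = {(a, b). a \<in> carrier S \<and> b \<in> carrier S
     \<and> principal_ideal S a = principal_ideal S b}"

definition monoid_J_class :: "('s, 'm) monoid_scheme \<Rightarrow> 's set \<Rightarrow> 's \<Rightarrow> bool" where
  "monoid_J_class S J e \<longleftrightarrow>
     J \<in> carrier S // green_J S
     \<and> (\<forall>a\<in>J. \<forall>b\<in>J. a \<otimes>\<^bsub>S\<^esub> b \<in> J)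
     \<and> e \<in> J \<and> (\<forall>a\<in>J. e \<otimes>\<^bsub>S\<^esub> a = a \<and> a \<otimes>\<^bsub>S\<^esub> e = a)"


section \<open>Right acts\<close>

locale right_act = monoid S for S :: "('s, 'm) monoid_scheme" (structure) +
  fixes A :: "'a set" and act :: "'a \<Rightarrow> 's \<Rightarrow> 'a"
  assumes act_closed: "a \<in> A \<Longrightarrow> s \<in> carrier S \<Longrightarrow> act a s \<in> A"
    and act_one: "a \<in> A \<Longrightarrow> act a \<one> = a"
    and act_mult: "a \<in> A \<Longrightarrow> s \<in> carrier S \<Longrightarrow> t \<in> carrier S \<Longrightarrow>
      act a (s \<otimes> t) = act (act a s) t"

text \<open>The empty set is a subact.\<close>

definition subact :: "('s, 'm) monoid_scheme \<Rightarrow> 'a set \<Rightarrow> 'a set \<Rightarrow> ('a \<Rightarrow> 's \<Rightarrow> 'a) \<Rightarrow> bool" where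
  "subact S B A act \<longleftrightarrow> B \<subseteq> A \<and> (\<forall>b\<in>B. \<forall>s\<in>carrier S. act b s \<in> B)"

definition fin_gen_act :: "('s, 'm) monoid_scheme \<Rightarrow> 'a set \<Rightarrow> ('a \<Rightarrow> 's \<Rightarrow> 'a) \<Rightarrow> bool" where
  "fin_gen_act S A act \<longleftrightarrow>
     (\<exists>G. finite G \<and> G \<subseteq> A \<and> A = (\<Union>a\<in>G. {act a s | s. s \<in> carrier S}))"

definition act_iso ::
  "('s, 'm) monoid_scheme \<Rightarrow> 'a set \<Rightarrow> ('a \<Rightarrow> 's \<Rightarrow> 'a) \<Rightarrow> 'b set \<Rightarrow> ('b \<Rightarrow> 's \<Rightarrow> 'b) \<Rightarrow> ('a \<Rightarrow> 'b) \<Rightarrow> bool" where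
  "act_iso S A act B act' f \<longleftrightarrow>
     bij_betw f A B \<and> (\<forall>a\<in>A. \<forall>s\<in>carrier S. f (act a s) = act' (f a) s)"

definition act_congruence ::
  "('s, 'm) monoid_scheme \<Rightarrow> 'a set \<Rightarrow> ('a \<Rightarrow> 's \<Rightarrow> 'a) \<Rightarrow> 'a rel \<Rightarrow> bool" where
  "act_congruence S A act r \<longleftrightarrow>
     equiv A r \<and> (\<forall>(a, b)\<in>r. \<forall>s\<in>carrier S. (act a s, act b s) \<in> r)"

definition fin_gen_congruence ::
  "('s, 'm) monoid_scheme \<Rightarrow> 'a set \<Rightarrow> ('a \<Rightarrow> 's \<Rightarrow> 'a) \<Rightarrow> 'a rel \<Rightarrow> bool" where
  "fin_gen_congruence S A act r \<longleftrightarrow>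
     act_congruence S A act r
     \<and> (\<exists>H. finite H \<and> H \<subseteq> r
          \<and> (\<forall>r'. act_congruence S A act r' \<and> H \<subseteq> r' \<longrightarrow> r \<subseteq> r'))"

text \<open>The action on the quotient \<open>A // r\<close>: the class of \<open>a\<close> is sent by \<open>s\<close> to the class of
  \<open>act a s\<close>, see \<open>quot_act_class\<close> below.\<close>

definition quot_act :: "('a \<Rightarrow> 's \<Rightarrow> 'a) \<Rightarrow> 'a rel \<Rightarrow> 'a set \<Rightarrow> 's \<Rightarrow> 'a set" where
  "quot_act act r C s = r `` ((\<lambda>a. act a s) ` C)"

text \<open>The free act on \<open>X\<close> has carrier \<open>X \<times> carrier S\<close>.\<close>

definition free_act :: "('s, 'm) monoid_scheme \<Rightarrow> 'x \<times> 's \<Rightarrow> 's \<Rightarrow> 'x \<times> 's" where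
  "free_act S p t = (fst p, snd p \<otimes>\<^bsub>S\<^esub> t)"

text \<open>Finite generating sets are taken inside \<open>nat\<close>; by \<open>fin_presented_actI\<close> below,
  finite sets of any other type give the same notion.\<close>

definition fin_presented_act :: "('s, 'm) monoid_scheme \<Rightarrow> 'a set \<Rightarrow> ('a \<Rightarrow> 's \<Rightarrow> 'a) \<Rightarrow> bool" where
  "fin_presented_act S A act \<longleftrightarrow>
     right_act S A act
     \<and> (\<exists>(X :: nat set) r f. finite X
          \<and> fin_gen_congruence S (X \<times> carrier S) (free_act S) r
          \<and> act_iso S A act ((X \<times> carrier S) // r) (quot_act (free_act S) r) f)"

text \<open>HOL cannot quantify over types inside a definition, so the ambient finitely presented acts
  range over acts whose elements are of type \<open>(nat \<times> 's) set\<close>. Up to isomorphism these are all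
  of them, since \<open>(X \<times> carrier S) // r\<close> has elements of this type; \<open>right_coherent_act\<close> below
  derives the property for acts over an arbitrary type.\<close>

definition right_coherent :: "('s, 'm) monoid_scheme \<Rightarrow> bool" where
  "right_coherent S \<longleftrightarrow>
     monoid S
     \<and> (\<forall>(A :: (nat \<times> 's) set set) act B.
          fin_presented_act S A act \<and> subact S B A act \<and> fin_gen_act S B act
          \<longrightarrow> fin_presented_act S B act)"


section \<open>Independence of the choice of types\<close>

lemma quot_act_class:
  assumes r: "act_congruence S A act r" and a: "a \<in> A" and s: "s \<in> carrier S"
  shows "quot_act act r (r `` {a}) s = r `` {act a s}"
proof -
  have eq: "equiv A r" and c: "\<And>a b. (a, b) \<in> r \<Longrightarrow> (act a s, act b s) \<in> r"
    using r s by (auto simp: act_congruence_def)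
  have aa: "(a, a) \<in> r" using eq a by (simp add: equiv_def refl_on_def)
  have tr: "trans r" using eq by (simp add: equiv_def)
  show ?thesis unfolding quot_act_def using aa c tr by (auto dest: transD)
qed

lemma free_right_act:
  assumes "monoid S" shows "right_act S (X \<times> carrier S) (free_act S)"
proof -
  interpret monoid S by fact
  show ?thesis by unfold_locales (auto simp: free_act_def m_assoc)
qed

lemma quot_right_act:
  assumes "right_act S A act" and r: "act_congruence S A act r"
  shows "right_act S (A // r) (quot_act act r)"
proof -
  interpret right_act S A act by fact
  show ?thesis
    by unfold_locales
      (auto elim!: quotientE simp: quot_act_class[OF r] act_closed act_one act_mult intro!: quotientI)
qed

lemma act_iso_trans:
  assumes "act_iso S A a B b f" "act_iso S B b C c g"
  shows "act_iso S A a C c (g \<circ> f)"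
  using assms by (auto simp: act_iso_def intro: bij_betw_trans dest: bij_betwE)

lemma act_iso_inv:
  assumes "right_act S A a" "act_iso S A a B b f"
  shows "act_iso S B b A a (inv_into A f)"
proof -
  interpret right_act S A a by fact
  have bij: "bij_betw f A B" and h: "\<And>x s. x \<in> A \<Longrightarrow> s \<in> carrier S \<Longrightarrow> f (a x s) = b (f x) s"
    using assms(2) by (auto simp: act_iso_def)
  have "inv_into A f (b y s) = a (inv_into A f y) s" if "y \<in> B" "s \<in> carrier S" for y s
  proof -
    have x: "inv_into A f y \<in> A" "f (inv_into A f y) = y"
      using bij that(1) by (auto simp: bij_betw_def inv_into_into f_inv_into_f)
    have "b y s = f (a (inv_into A f y) s)" using h[OF x(1) that(2)] x(2) by simp
    then show ?thesis using bij act_closed[OF x(1) that(2)] by (simp add: bij_betw_def)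
  qed
  then show ?thesis using bij by (simp add: act_iso_def bij_betw_inv_into)
qed

lemma fin_presented_act_iso:
  assumes "right_act S A a" "act_iso S A a B b f" "fin_presented_act S B b"
  shows "fin_presented_act S A a"
  using assms act_iso_trans[OF assms(2)] unfolding fin_presented_act_def by blast

lemma act_congruence_transport:
  assumes "right_act S A a" "act_iso S A a B b f" "act_congruence S A a r"
  shows "act_congruence S B b (map_prod f f ` r)"
proof -
  interpret right_act S A a by fact
  have bij: "bij_betw f A B" and h: "\<And>x s. x \<in> A \<Longrightarrow> s \<in> carrier S \<Longrightarrow> f (a x s) = b (f x) s"
    using assms(2) by (auto simp: act_iso_def)
  have sub: "r \<subseteq> A \<times> A" and rf: "\<And>x. x \<in> A \<Longrightarrow> (x, x) \<in> r" and sy: "sym r" and tr: "trans r"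
    and c: "\<And>x y s. (x, y) \<in> r \<Longrightarrow> s \<in> carrier S \<Longrightarrow> (a x s, a y s) \<in> r"
    using assms(3) by (auto simp: act_congruence_def equiv_def refl_on_def)
  have "trans (map_prod f f ` r)"
  proof (rule transI)
    fix x y z assume "(x, y) \<in> map_prod f f ` r" "(y, z) \<in> map_prod f f ` r"
    then obtain p q q' w where pq: "(p, q) \<in> r" "(q', w) \<in> r" "x = f p" "y = f q" "y = f q'" "z = f w"
      by auto
    then have "q = q'" using bij sub by (auto simp: bij_betw_def dest: inj_onD)
    then have "(p, w) \<in> r" using pq tr by (auto dest: transD)
    then show "(x, z) \<in> map_prod f f ` r" using pq by force
  qed
  moreover have "sym (map_prod f f ` r)"
    using sy by (force intro!: symI dest: symD)
  moreover have "map_prod f f ` r \<subseteq> B \<times> B"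
    using sub bij by (auto simp: bij_betw_def)
  moreover have "(y, y) \<in> map_prod f f ` r" if "y \<in> B" for y
  proof -
    obtain x where "x \<in> A" "y = f x" using bij \<open>y \<in> B\<close> by (auto simp: bij_betw_def)
    then show ?thesis using rf[of x] by force
  qed
  ultimately have "equiv B (map_prod f f ` r)" by (auto simp: equiv_def refl_on_def)
  moreover have "(b u s, b v s) \<in> map_prod f f ` r"
    if uv: "(u, v) \<in> map_prod f f ` r" and s: "s \<in> carrier S" for u v s
  proof -
    obtain x y where xy: "(x, y) \<in> r" "u = f x" "v = f y" using uv by auto
    then have "b u s = f (a x s)" "b v s = f (a y s)" using sub h s by auto
    then show ?thesis using c[OF xy(1) s] by force
  qed
  ultimately show ?thesis unfolding act_congruence_def by blast
qed

lemma fin_gen_congruence_transport: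
  assumes A: "right_act S A a" and B: "right_act S B b" and f: "act_iso S A a B b f"
    and r: "fin_gen_congruence S A a r"
  shows "fin_gen_congruence S B b (map_prod f f ` r)"
proof -
  obtain H where c: "act_congruence S A a r" and H: "finite H" "H \<subseteq> r"
    and min: "\<And>r'. act_congruence S A a r' \<Longrightarrow> H \<subseteq> r' \<Longrightarrow> r \<subseteq> r'"
    using r by (auto simp: fin_gen_congruence_def)
  have bij: "bij_betw f A B" using f by (simp add: act_iso_def)
  have sub: "r \<subseteq> A \<times> A" using c by (auto simp: act_congruence_def equiv_def)
  let ?g = "inv_into A f"
  have "map_prod f f ` r \<subseteq> r'"
    if r': "act_congruence S B b r'" and Hr': "map_prod f f ` H \<subseteq> r'" for r'
  proof -
    have sub': "r' \<subseteq> B \<times> B" using r' by (auto simp: act_congruence_def equiv_def)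
    have "act_congruence S A a (map_prod ?g ?g ` r')"
      by (rule act_congruence_transport[OF B act_iso_inv[OF A f] r'])
    moreover have "H \<subseteq> map_prod ?g ?g ` r'"
    proof
      fix h assume h: "h \<in> H"
      then have "map_prod ?g ?g (map_prod f f h) = h"
        using H sub bij by (auto simp: bij_betw_def)
      then show "h \<in> map_prod ?g ?g ` r'" using h Hr' by (metis image_eqI image_subset_iff)
    qed
    ultimately have rsub: "r \<subseteq> map_prod ?g ?g ` r'" by (rule min)
    show ?thesis
    proof
      fix p assume "p \<in> map_prod f f ` r"
      then obtain p' where p': "p' \<in> r" "p = map_prod f f p'" by (rule imageE)
      obtain q where q: "q \<in> r'" "p' = map_prod ?g ?g q"
        using subsetD[OF rsub p'(1)] by (rule imageE)
      have "q \<in> f ` A \<times> f ` A" using q(1) sub' bij by (auto simp: bij_betw_def)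
      then have "map_prod f f (map_prod ?g ?g q) = q"
        by (metis f_inv_into_f map_prod_simp mem_Sigma_iff surj_pair)
      then show "p \<in> r'" using q p' by simp
    qed
  qed
  moreover have "finite (map_prod f f ` H)" "map_prod f f ` H \<subseteq> map_prod f f ` r"
    using H by auto
  ultimately show ?thesis
    unfolding fin_gen_congruence_def
    by (intro conjI exI[of _ "map_prod f f ` H"] act_congruence_transport[OF A f c]) auto
qed

lemma quot_act_iso_transport:
  assumes A: "right_act S A a" and f: "act_iso S A a B b f" and r: "act_congruence S A a r"
  shows "act_iso S (A // r) (quot_act a r) (B // (map_prod f f ` r)) (quot_act b (map_prod f f ` r))
    ((`) f)"
proof -
  interpret right_act S A a by fact
  let ?r = "map_prod f f ` r"
  have bij: "bij_betw f A B" and h: "\<And>x s. x \<in> A \<Longrightarrow> s \<in> carrier S \<Longrightarrow> f (a x s) = b (f x) s"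
    using f by (auto simp: act_iso_def)
  have sub: "r \<subseteq> A \<times> A" using r by (auto simp: act_congruence_def equiv_def)
  have cl: "f ` (r `` {x}) = ?r `` {f x}" if "x \<in> A" for x
  proof (rule subset_antisym; rule subsetI)
    fix y assume "y \<in> f ` (r `` {x})"
    then show "y \<in> ?r `` {f x}" by force
  next
    fix y assume "y \<in> ?r `` {f x}"
    then obtain p q where pq: "(p, q) \<in> r" "f x = f p" "y = f q" by auto
    then have "x = p" using that bij sub by (auto simp: bij_betw_def dest: inj_onD)
    then show "y \<in> f ` (r `` {x})" using pq by blast
  qed
  have "(`) f ` (A // r) = B // ?r"
  proof -
    have "(`) f ` (A // r) = (\<lambda>x. f ` (r `` {x})) ` A" by (auto simp: quotient_def)
    also have "\<dots> = (\<lambda>x. ?r `` {f x}) ` A" using cl by (rule image_cong[OF refl])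
    also have "\<dots> = B // ?r" using bij by (auto simp: quotient_def bij_betw_def)
    finally show ?thesis .
  qed
  moreover have "inj_on ((`) f) (A // r)"
  proof (rule inj_onI)
    fix C D assume CD: "C \<in> A // r" "D \<in> A // r" and e: "f ` C = f ` D"
    have "C \<subseteq> A" "D \<subseteq> A" using CD sub by (auto elim!: quotientE)
    then show "C = D" using e bij by (auto simp: bij_betw_def inj_on_image_eq_iff)
  qed
  moreover have "f ` quot_act a r C s = quot_act b ?r (f ` C) s"
    if C: "C \<in> A // r" and s: "s \<in> carrier S" for C s
  proof -
    obtain x where x: "x \<in> A" "C = r `` {x}" using C by (auto elim!: quotientE)
    have fx: "f x \<in> B" using x bij by (auto simp: bij_betw_def)
    show ?thesis
      using x s fx by (simp add: quot_act_class[OF r] cl act_closed h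
          quot_act_class[OF act_congruence_transport[OF A f r]])
  qed
  ultimately show ?thesis by (auto simp: act_iso_def bij_betw_def)
qed

lemma fin_presented_actI:
  fixes X :: "'x set"
  assumes A: "right_act S A act" and X: "finite X"
    and r: "fin_gen_congruence S (X \<times> carrier S) (free_act S) r"
    and f: "act_iso S A act ((X \<times> carrier S) // r) (quot_act (free_act S) r) f"
  shows "fin_presented_act S A act"
proof -
  have m: "monoid S" using A by (simp add: right_act_def)
  obtain g :: "'x \<Rightarrow> nat" where g: "inj_on g X"
    using finite_imp_inj_to_nat_seg[OF X] by blast
  let ?r = "map_prod (map_prod g id) (map_prod g id) ` r"
  have h: "act_iso S (X \<times> carrier S) (free_act S) (g ` X \<times> carrier S) (free_act S) (map_prod g id)"
    using g by (force simp: act_iso_def bij_betw_def free_act_def inj_on_def)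
  have gr: "fin_gen_congruence S (g ` X \<times> carrier S) (free_act S) ?r"
    by (rule fin_gen_congruence_transport[OF free_right_act[OF m] free_right_act[OF m] h r])
  have "act_congruence S (X \<times> carrier S) (free_act S) r"
    using r by (simp add: fin_gen_congruence_def)
  then have "act_iso S A act ((g ` X \<times> carrier S) // ?r) (quot_act (free_act S) ?r)
      ((`) (map_prod g id) \<circ> f)"
    by (rule act_iso_trans[OF f quot_act_iso_transport[OF free_right_act[OF m] h]])
  then show ?thesis
    using A X gr unfolding fin_presented_act_def by (intro conjI exI) auto
qed

lemma right_coherent_act:
  fixes A :: "'a set"
  assumes S: "right_coherent S" and A: "fin_presented_act S A act"
    and B: "subact S B A act" "fin_gen_act S B act"
  shows "fin_presented_act S B act"
proof -
  obtain X :: "nat set" and r f where X: "finite X"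
    and r: "fin_gen_congruence S (X \<times> carrier S) (free_act S) r"
    and f: "act_iso S A act ((X \<times> carrier S) // r) (quot_act (free_act S) r) f"
    and actA: "right_act S A act"
    using A by (auto simp: fin_presented_act_def)
  interpret right_act S A act by fact
  let ?Q = "(X \<times> carrier S) // r" and ?q = "quot_act (free_act S) r"
  have "right_act S ?Q ?q"
    using r by (intro quot_right_act free_right_act)
      (auto simp: fin_gen_congruence_def monoid_axioms)
  moreover have "act_iso S ?Q ?q ?Q ?q id" by (simp add: act_iso_def)
  ultimately have Q: "fin_presented_act S ?Q ?q" using X r by (blast intro: fin_presented_actI)
  have bij: "bij_betw f A ?Q"
    and h: "\<And>x s. x \<in> A \<Longrightarrow> s \<in> carrier S \<Longrightarrow> ?q (f x) s = f (act x s)"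
    using f by (auto simp: act_iso_def)
  have BA: "B \<subseteq> A" and Bcl: "\<And>x s. x \<in> B \<Longrightarrow> s \<in> carrier S \<Longrightarrow> act x s \<in> B"
    using B(1) by (auto simp: subact_def)
  have hB: "?q (f x) s = f (act x s)" if "x \<in> B" "s \<in> carrier S" for x s
    using h that BA by blast
  have actB: "right_act S B act"
    using BA by unfold_locales (auto simp: Bcl act_one act_mult)
  have "f ` B \<subseteq> ?Q" using BA bij by (auto simp: bij_betw_def)
  then have "subact S (f ` B) ?Q ?q" by (auto simp: subact_def hB Bcl)
  moreover have "fin_gen_act S (f ` B) ?q"
  proof -
    obtain G where G: "finite G" "G \<subseteq> B" "B = (\<Union>a\<in>G. {act a s | s. s \<in> carrier S})"
      using B(2) unfolding fin_gen_act_def by (elim exE conjE) (rule that)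
    have "f ` B = (\<Union>a\<in>G. f ` {act a s | s. s \<in> carrier S})" by (subst G(3)) blast
    also have "\<dots> = (\<Union>a\<in>G. {?q (f a) s | s. s \<in> carrier S})"
    proof (rule SUP_cong[OF refl])
      fix a assume "a \<in> G"
      then have "a \<in> B" using G(2) by blast
      then show "f ` {act a s | s. s \<in> carrier S} = {?q (f a) s | s. s \<in> carrier S}"
        using hB[of a] by (force simp: image_iff)
    qed
    also have "\<dots> = (\<Union>c\<in>f ` G. {?q c s | s. s \<in> carrier S})" by blast
    finally have "f ` B = (\<Union>c\<in>f ` G. {?q c s | s. s \<in> carrier S})" .
    moreover have "finite (f ` G)" "f ` G \<subseteq> f ` B" using G(1,2) by auto
    ultimately show ?thesis unfolding fin_gen_act_def by blast
  qed
  ultimately have "fin_presented_act S (f ` B) ?q"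
    using S Q unfolding right_coherent_def by blast
  moreover have "act_iso S B act (f ` B) ?q f"
    using bij BA by (auto simp: act_iso_def bij_betw_def hB intro: inj_on_subset)
  ultimately show ?thesis by (rule fin_presented_act_iso[OF actB, rotated])
qed

end

(* For s, t in S one has e s t : J iff e s : J and e t : J, and then e s t = (e s)(e t).
   Hence a J-congruence r on F_J(X) extends to an S-congruence on F_S(X) by comparing (x, e s) with
   (y, e t) when e s and e t lie in J and collapsing everything else. Its existence shows that the
   S-congruence generated by a finite set H of pairs over J restricts on F_J(X) to the J-congruence
   generated by H, so a finitely presented J-act embeds in a finitely presented S-act. Coherence
   of S gives a finite presentation of the S-subact generated by a given finite set; the same
   extension shows that the relations of this presentation that lie over J, multiplied by e,
   present the J-subact. *)

theory Submission
  imports Defs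
begin

section \<open>Congruences on acts: preimages and finite generation\<close>

section \<open>Congruences\<close>

lemma act_congruence_iff:
  "act_congruence S A act r \<longleftrightarrow> r \<subseteq> A \<times> A \<and> (\<forall>a\<in>A. (a, a) \<in> r) \<and> sym r \<and> trans r
     \<and> (\<forall>a b. \<forall>s\<in>carrier S. (a, b) \<in> r \<longrightarrow> (act a s, act b s) \<in> r)"
  unfolding act_congruence_def equiv_def refl_on_def by auto

text \<open>Minimality of a generated congruence is applied to preimages of this kind. The
  assumptions stop short of requiring acts, because in \<open>generated_congruence_restrict\<close>
  the set \<open>X \<times> carrier S\<close> need not be an act over \<open>T\<close>: there
  \<open>e\<close> may fail to act as the identity.\<close>

lemma act_congruence_pullback:
  assumes r: "act_congruence S B b r"
    and h: "\<And>x. x \<in> A \<Longrightarrow> h x \<in> B"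
    and closed: "\<And>x s. x \<in> A \<Longrightarrow> s \<in> carrier S \<Longrightarrow> a x s \<in> A"
    and hom: "\<And>x s. x \<in> A \<Longrightarrow> s \<in> carrier S \<Longrightarrow> h (a x s) = b (h x) s"
  shows "act_congruence S A a {(x, y). x \<in> A \<and> y \<in> A \<and> (h x, h y) \<in> r}"
proof -
  have r: "\<forall>a\<in>B. (a, a) \<in> r" "sym r" "trans r"
    "\<forall>x y. \<forall>s\<in>carrier S. (x, y) \<in> r \<longrightarrow> (b x s, b y s) \<in> r"
    using r by (auto simp: act_congruence_iff)
  show ?thesis
    unfolding act_congruence_iff
  proof (intro conjI)
    show "sym {(x, y). x \<in> A \<and> y \<in> A \<and> (h x, h y) \<in> r}"
      using r(2) by (auto intro!: symI dest: symD)
    show "trans {(x, y). x \<in> A \<and> y \<in> A \<and> (h x, h y) \<in> r}"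
      using r(3) by (auto intro!: transI dest: transD)
  qed (use r(1,4) h closed hom in auto)
qed

lemma fin_gen_congruenceI:
  assumes "act_congruence S A act r" "finite H" "H \<subseteq> r"
    and "\<And>r'. act_congruence S A act r' \<Longrightarrow> H \<subseteq> r' \<Longrightarrow> r \<subseteq> r'"
  shows "fin_gen_congruence S A act r"
  unfolding fin_gen_congruence_def
  by (intro conjI exI[of _ H] allI impI assms) auto

lemma fin_gen_congruence_generated:
  assumes "right_act S A act" and H: "finite H" "H \<subseteq> A \<times> A"
  obtains r where "fin_gen_congruence S A act r" "H \<subseteq> r"
    "\<And>r'. act_congruence S A act r' \<Longrightarrow> H \<subseteq> r' \<Longrightarrow> r \<subseteq> r'"
proof -
  interpret right_act S A act by fact
  define C where "C = {r. act_congruence S A act r \<and> H \<subseteq> r}"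
  have C: "r \<subseteq> A \<times> A \<and> (\<forall>a\<in>A. (a, a) \<in> r) \<and> sym r \<and> trans r
     \<and> (\<forall>a b. \<forall>s\<in>carrier S. (a, b) \<in> r \<longrightarrow> (act a s, act b s) \<in> r)" if "r \<in> C" for r
    using that unfolding C_def by (simp add: act_congruence_iff)
  \<comment> \<open>The total relation keeps the family nonempty, so its intersection lies inside
    \<open>A \<times> A\<close>; the intersection of the empty family would be
    \<open>UNIV\<close>.\<close>
  have top: "A \<times> A \<in> C"
    using H(2) by (simp add: C_def act_congruence_iff act_closed sym_def trans_def)
  have c: "act_congruence S A act (\<Inter>C)"
    unfolding act_congruence_iff
  proof (intro conjI)
    show "sym (\<Inter>C)" using C by (meson InterE InterI symD symI)
    show "trans (\<Inter>C)" using C by (meson InterE InterI transD transI)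
    show "\<Inter>C \<subseteq> A \<times> A" using top by (rule Inter_lower)
    show "\<forall>a\<in>A. (a, a) \<in> \<Inter>C" using C by blast
    show "\<forall>a b. \<forall>s\<in>carrier S. (a, b) \<in> \<Inter>C \<longrightarrow> (act a s, act b s) \<in> \<Inter>C"
    proof (intro allI ballI impI InterI)
      fix a b s r assume "s \<in> carrier S" "(a, b) \<in> \<Inter>C" "r \<in> C"
      then show "(act a s, act b s) \<in> r" using C[of r] by (meson InterD)
    qed
  qed
  have H': "H \<subseteq> \<Inter>C" by (auto simp: C_def)
  have min: "\<Inter>C \<subseteq> r'" if "act_congruence S A act r'" "H \<subseteq> r'" for r'
    using that by (auto simp: C_def)
  from c H(1) H' min have "fin_gen_congruence S A act (\<Inter>C)" by (rule fin_gen_congruenceI)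
  then show ?thesis using H' min by (rule that)
qed

section \<open>Presentations as kernels of generating families, and change of generators\<close>

section \<open>Presentations by generators\<close>

text \<open>When \<open>\<gamma>\<close> takes values in an act, this is the kernel of the act
  morphism from the free act on \<open>X\<close> that sends \<open>(x, \<one>)\<close> to
  \<open>\<gamma> x\<close>.\<close>

definition presentation_kernel ::
  "('s, 'm) monoid_scheme \<Rightarrow> ('a \<Rightarrow> 's \<Rightarrow> 'a) \<Rightarrow> 'x set \<Rightarrow> ('x \<Rightarrow> 'a) \<Rightarrow> ('x \<times> 's) rel" where
  "presentation_kernel S act X \<gamma> = {(p, q). p \<in> X \<times> carrier S \<and> q \<in> X \<times> carrier S
     \<and> act (\<gamma> (fst p)) (snd p) = act (\<gamma> (fst q)) (snd q)}"

text \<open>A family and not a subset: the generators numbered by \<open>nat\<close> in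
  \<open>fin_presented_act\<close> and a finite subset with \<open>id\<close> are then handled
  alike, and one index set can serve two different acts.\<close>

definition generates ::
  "('s, 'm) monoid_scheme \<Rightarrow> 'a set \<Rightarrow> ('a \<Rightarrow> 's \<Rightarrow> 'a) \<Rightarrow> 'x set \<Rightarrow> ('x \<Rightarrow> 'a) \<Rightarrow> bool" where
  "generates S A act X \<gamma> \<longleftrightarrow> \<gamma> ` X \<subseteq> A \<and> (\<forall>a\<in>A. \<exists>x\<in>X. \<exists>s\<in>carrier S. a = act (\<gamma> x) s)"

lemma presentation_kernel_congruence:
  fixes S :: "('s, 'm) monoid_scheme" (structure)
  assumes "right_act S A act" and "\<gamma> ` X \<subseteq> A"
  shows "act_congruence S (X \<times> carrier S) (free_act S) (presentation_kernel S act X \<gamma>)"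
proof -
  interpret right_act S A act by fact
  have eq: "act (\<gamma> x) (s \<otimes> t) = act (act (\<gamma> x) s) t"
    if "x \<in> X" "s \<in> carrier S" "t \<in> carrier S" for x s t
    using assms(2) that by (intro act_mult) auto
  show ?thesis
    unfolding act_congruence_iff
  proof (intro conjI)
    show "sym (presentation_kernel S act X \<gamma>)"
      by (auto simp: presentation_kernel_def intro!: symI)
    show "trans (presentation_kernel S act X \<gamma>)"
      by (auto simp: presentation_kernel_def intro!: transI)
  qed (auto simp: presentation_kernel_def free_act_def eq)
qed

text \<open>First isomorphism theorem: the fibres of the surjection from the free act are the
  classes of its kernel, so sending each element of \<open>A\<close> to its fibre \<open>F a\<close>
  is an isomorphism onto the quotient.\<close>

lemma fin_presented_act_of_kernel:
  fixes S :: "('s, 'm) monoid_scheme" (structure)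
  assumes A: "right_act S A act" and X: "finite X" and gen: "generates S A act X \<gamma>"
    and ker: "fin_gen_congruence S (X \<times> carrier S) (free_act S) (presentation_kernel S act X \<gamma>)"
  shows "fin_presented_act S A act"
proof -
  interpret right_act S A act by fact
  let ?K = "presentation_kernel S act X \<gamma>"
  define F where "F a = {p \<in> X \<times> carrier S. act (\<gamma> (fst p)) (snd p) = a}" for a
  have \<gamma>: "\<gamma> x \<in> A" if "x \<in> X" for x using gen that by (auto simp: generates_def)
  have surj: "\<exists>x\<in>X. \<exists>s\<in>carrier S. a = act (\<gamma> x) s" if "a \<in> A" for a
    using gen that by (auto simp: generates_def)
  have F: "F (act (\<gamma> x) s) = ?K `` {(x, s)}" if "x \<in> X" "s \<in> carrier S" for x s
    using that by (auto simp: F_def presentation_kernel_def)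
  have con: "act_congruence S (X \<times> carrier S) (free_act S) ?K"
    using ker by (simp add: fin_gen_congruence_def)
  have "inj_on F A"
  proof (rule inj_onI)
    fix a b assume ab: "a \<in> A" "b \<in> A" "F a = F b"
    obtain x s where "x \<in> X" "s \<in> carrier S" "a = act (\<gamma> x) s" using surj[OF ab(1)] by blast
    then have "(x, s) \<in> F a" by (simp add: F_def)
    then have "(x, s) \<in> F b" using ab by simp
    then show "a = b" using \<open>a = _\<close> by (simp add: F_def)
  qed
  moreover have "F ` A = (X \<times> carrier S) // ?K"
  proof (intro subset_antisym subsetI)
    fix C assume "C \<in> F ` A"
    then obtain a where a: "a \<in> A" "C = F a" by blast
    obtain x s where "x \<in> X" "s \<in> carrier S" "a = act (\<gamma> x) s" using surj[OF a(1)] by blast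
    then show "C \<in> (X \<times> carrier S) // ?K" using F a(2) by (auto intro!: quotientI)
  next
    fix C assume "C \<in> (X \<times> carrier S) // ?K"
    then obtain x s where "x \<in> X" "s \<in> carrier S" "C = ?K `` {(x, s)}"
      by (auto elim!: quotientE)
    then show "C \<in> F ` A" using F[of x s] \<gamma> act_closed by blast
  qed
  moreover have "F (act a t) = quot_act (free_act S) ?K (F a) t"
    if a: "a \<in> A" and t: "t \<in> carrier S" for a t
  proof -
    obtain x s where x: "x \<in> X" "s \<in> carrier S" "a = act (\<gamma> x) s" using surj[OF a] by blast
    have "F (act a t) = F (act (\<gamma> x) (s \<otimes> t))" using x t \<gamma> by (simp add: act_mult)
    then show ?thesis
      using x t F[of x "s \<otimes> t"] F[of x s] by (simp add: quot_act_class[OF con] free_act_def)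
  qed
  ultimately have "act_iso S A act ((X \<times> carrier S) // ?K) (quot_act (free_act S) ?K) F"
    by (simp add: act_iso_def bij_betw_def)
  then show ?thesis by (rule fin_presented_actI[OF A X ker])
qed

text \<open>Pulling the classes of the \<open>(x, \<one>)\<close> back along the isomorphism
  \<open>f\<close> gives generators whose kernel is exactly the given congruence
  \<open>r\<close>.\<close>

lemma fin_presented_act_kernel:
  fixes S :: "('s, 'm) monoid_scheme" (structure)
  assumes "fin_presented_act S A act"
  obtains X :: "nat set" and \<gamma> where "finite X" "generates S A act X \<gamma>"
    "fin_gen_congruence S (X \<times> carrier S) (free_act S) (presentation_kernel S act X \<gamma>)"
proof -
  obtain X :: "nat set" and r f where A: "right_act S A act" and X: "finite X"
    and r: "fin_gen_congruence S (X \<times> carrier S) (free_act S) r"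
    and f: "act_iso S A act ((X \<times> carrier S) // r) (quot_act (free_act S) r) f"
    using assms by (auto simp: fin_presented_act_def)
  interpret right_act S A act by fact
  have con: "act_congruence S (X \<times> carrier S) (free_act S) r"
    using r by (simp add: fin_gen_congruence_def)
  have eqv: "equiv (X \<times> carrier S) r" using con by (simp add: act_congruence_def)
  have bij: "bij_betw f A ((X \<times> carrier S) // r)"
    and h: "\<And>a s. a \<in> A \<Longrightarrow> s \<in> carrier S \<Longrightarrow> f (act a s) = quot_act (free_act S) r (f a) s"
    using f by (auto simp: act_iso_def)
  define \<gamma> where "\<gamma> x = inv_into A f (r `` {(x, \<one>)})" for x
  have \<gamma>: "\<gamma> x \<in> A \<and> f (\<gamma> x) = r `` {(x, \<one>)}" if "x \<in> X" for x
  proof -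
    have "r `` {(x, \<one>)} \<in> f ` A" using bij that by (auto simp: bij_betw_def intro!: quotientI)
    then show ?thesis unfolding \<gamma>_def by (simp add: inv_into_into f_inv_into_f)
  qed
  have f\<gamma>: "f (act (\<gamma> x) s) = r `` {(x, s)}" if "x \<in> X" "s \<in> carrier S" for x s
    using that \<gamma>[of x] by (simp add: h quot_act_class[OF con] free_act_def)
  have inj: "a = b" if "a \<in> A" "b \<in> A" "f a = f b" for a b
    using that bij by (auto simp: bij_betw_def dest: inj_onD)
  have gen: "generates S A act X \<gamma>"
    unfolding generates_def
  proof (intro conjI ballI)
    fix a assume a: "a \<in> A"
    then have "f a \<in> (X \<times> carrier S) // r" using bij by (auto simp: bij_betw_def)
    then obtain x s where x: "x \<in> X" "s \<in> carrier S" "f a = r `` {(x, s)}"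
      by (auto elim!: quotientE)
    then have "a = act (\<gamma> x) s" using a \<gamma>[of x] by (intro inj) (auto simp: act_closed f\<gamma>)
    then show "\<exists>x\<in>X. \<exists>s\<in>carrier S. a = act (\<gamma> x) s" using x by blast
  qed (use \<gamma> in auto)
  have "(act (\<gamma> x) s = act (\<gamma> y) t) = (((x, s), (y, t)) \<in> r)"
    if "x \<in> X" "y \<in> X" "s \<in> carrier S" "t \<in> carrier S" for x y s t
  proof -
    have "(act (\<gamma> x) s = act (\<gamma> y) t) = (f (act (\<gamma> x) s) = f (act (\<gamma> y) t))"
      using that \<gamma> inj[of "act (\<gamma> x) s" "act (\<gamma> y) t"] by (auto simp: act_closed)
    then show ?thesis using that by (simp add: f\<gamma> eq_equiv_class_iff[OF eqv])
  qed
  then have "presentation_kernel S act X \<gamma> = r"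
    using con by (auto simp: presentation_kernel_def act_congruence_iff)
  then show ?thesis using that X gen r by blast
qed

text \<open>Finite presentability does not depend on the finite generating family. As with Tietze
  transformations, two families are written in terms of each other. The relations of the family
  \<open>\<beta>\<close> are translated to \<open>\<gamma>\<close>, and for every \<open>g\<close>
  one adds the relation that translating \<open>\<gamma> g\<close> to \<open>\<beta>\<close> and
  back changes nothing.\<close>

lemma fin_gen_presentation_kernel:
  fixes S :: "('s, 'm) monoid_scheme" (structure)
  assumes fp: "fin_presented_act S A act" and G: "finite G" and gen: "generates S A act G \<gamma>"
  shows "fin_gen_congruence S (G \<times> carrier S) (free_act S) (presentation_kernel S act G \<gamma>)"
proof -
  have A: "right_act S A act" using fp by (simp add: fin_presented_act_def)
  interpret right_act S A act by fact
  obtain X :: "nat set" and \<beta> where X: "finite X" and genX: "generates S A act X \<beta>"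
    and ker: "fin_gen_congruence S (X \<times> carrier S) (free_act S) (presentation_kernel S act X \<beta>)"
    using fp by (rule fin_presented_act_kernel)
  obtain H where H: "finite H" "H \<subseteq> presentation_kernel S act X \<beta>"
    and min: "\<And>r'. act_congruence S (X \<times> carrier S) (free_act S) r' \<Longrightarrow> H \<subseteq> r' \<Longrightarrow>
        presentation_kernel S act X \<beta> \<subseteq> r'"
    using ker by (auto simp: fin_gen_congruence_def)
  have \<gamma>A: "\<gamma> g \<in> A" if "g \<in> G" for g using gen that by (auto simp: generates_def)
  have \<beta>A: "\<beta> x \<in> A" if "x \<in> X" for x using genX that by (auto simp: generates_def)
  have "\<forall>g\<in>G. \<exists>x s. x \<in> X \<and> s \<in> carrier S \<and> \<gamma> g = act (\<beta> x) s"
    using genX \<gamma>A unfolding generates_def by metis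
  then obtain w u where wu: "\<And>g. g \<in> G \<Longrightarrow> w g \<in> X"
      "\<And>g. g \<in> G \<Longrightarrow> u g \<in> carrier S" "\<And>g. g \<in> G \<Longrightarrow> \<gamma> g = act (\<beta> (w g)) (u g)"
    by metis
  have "\<forall>x\<in>X. \<exists>g s. g \<in> G \<and> s \<in> carrier S \<and> \<beta> x = act (\<gamma> g) s"
    using gen \<beta>A unfolding generates_def by metis
  then obtain k v where kv: "\<And>x. x \<in> X \<Longrightarrow> k x \<in> G"
      "\<And>x. x \<in> X \<Longrightarrow> v x \<in> carrier S" "\<And>x. x \<in> X \<Longrightarrow> \<beta> x = act (\<gamma> (k x)) (v x)"
    by metis
  \<comment> \<open>The morphism from the free act on \<open>X\<close> to the free act on
    \<open>G\<close> given by rewriting each \<open>\<beta> x\<close>; by \<open>\<phi>val\<close>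
    it preserves values in \<open>A\<close>.\<close>
  define \<phi> where "\<phi> p = (k (fst p), v (fst p) \<otimes> snd p)" for p
  define E where "E = (\<lambda>g. ((g, \<one>), \<phi> (w g, u g))) ` G \<union> map_prod \<phi> \<phi> ` H"
  have \<phi>: "\<phi> p \<in> G \<times> carrier S" if "p \<in> X \<times> carrier S" for p
    using that kv by (auto simp: \<phi>_def)
  have \<phi>hom: "\<phi> (free_act S p s) = free_act S (\<phi> p) s"
    if "p \<in> X \<times> carrier S" "s \<in> carrier S" for p s
    using that kv by (auto simp: \<phi>_def free_act_def m_assoc)
  have \<phi>val: "act (\<gamma> (fst (\<phi> p))) (snd (\<phi> p)) = act (\<beta> (fst p)) (snd p)"
    if "p \<in> X \<times> carrier S" for p
    using that kv \<gamma>A by (auto simp: \<phi>_def act_mult)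
  let ?K = "presentation_kernel S act G \<gamma>"
  have con: "act_congruence S (G \<times> carrier S) (free_act S) ?K"
    using gen by (intro presentation_kernel_congruence[OF A]) (simp add: generates_def)
  have EK: "E \<subseteq> ?K"
  proof -
    have "((g, \<one>), \<phi> (w g, u g)) \<in> ?K" if g: "g \<in> G" for g
      using wu[OF g] \<phi>[of "(w g, u g)"] \<phi>val[of "(w g, u g)"] g act_one[OF \<gamma>A[OF g]]
      by (auto simp: presentation_kernel_def)
    moreover have "(\<phi> p, \<phi> q) \<in> ?K" if "(p, q) \<in> presentation_kernel S act X \<beta>" for p q
      using that \<phi>[of p] \<phi>[of q] \<phi>val[of p] \<phi>val[of q] by (simp add: presentation_kernel_def)
    ultimately show ?thesis using H(2) by (auto simp: E_def)
  qed
  have minK: "?K \<subseteq> r'"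
    if r': "act_congruence S (G \<times> carrier S) (free_act S) r'" and E: "E \<subseteq> r'" for r'
  proof -
    have r'': "sym r'" "trans r'"
      "\<And>a b s. s \<in> carrier S \<Longrightarrow> (a, b) \<in> r' \<Longrightarrow> (free_act S a s, free_act S b s) \<in> r'"
      using r' by (auto simp: act_congruence_iff)
    \<comment> \<open>The preimage of \<open>r'\<close> under \<open>\<phi>\<close> contains
      \<open>H\<close>, hence the whole kernel of \<open>\<beta>\<close>.\<close>
    let ?P = "{(p, q). p \<in> X \<times> carrier S \<and> q \<in> X \<times> carrier S \<and> (\<phi> p, \<phi> q) \<in> r'}"
    have "act_congruence S (X \<times> carrier S) (free_act S) ?P"
    proof (rule act_congruence_pullback[where h = \<phi>, OF r'])
      show "free_act S p s \<in> X \<times> carrier S" if "p \<in> X \<times> carrier S" "s \<in> carrier S" for p s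
        using that by (cases p) (simp add: free_act_def)
    qed (simp_all only: \<phi> \<phi>hom)
    moreover have "H \<subseteq> ?P"
    proof (rule subrelI)
      fix p q assume pq: "(p, q) \<in> H"
      then have "map_prod \<phi> \<phi> (p, q) \<in> E" unfolding E_def by (intro UnI2 imageI)
      then have "(\<phi> p, \<phi> q) \<in> E" by simp
      moreover have "p \<in> X \<times> carrier S" "q \<in> X \<times> carrier S"
        using subsetD[OF H(2) pq] by (simp_all add: presentation_kernel_def)
      ultimately show "(p, q) \<in> ?P" using E by blast
    qed
    ultimately have P: "presentation_kernel S act X \<beta> \<subseteq> ?P" by (rule min)
    \<comment> \<open>Multiplying the round-trip pair of \<open>g\<close> by \<open>s\<close> moves
      every word over \<open>G\<close> into the image of \<open>\<phi>\<close>, modulo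
      \<open>r'\<close>.\<close>
    have step: "((g, s), \<phi> (w g, u g \<otimes> s)) \<in> r'" if g: "g \<in> G" and s: "s \<in> carrier S" for g s
    proof -
      have "((g, \<one>), \<phi> (w g, u g)) \<in> r'" using E g by (auto simp: E_def)
      from r''(3)[OF s this] show ?thesis
        using wu[OF g] s kv by (simp add: free_act_def \<phi>_def m_assoc)
    qed
    show ?thesis
    proof (rule subrelI)
      fix p q assume pq: "(p, q) \<in> ?K"
      obtain g s h t where [simp]: "p = (g, s)" "q = (h, t)" by (metis surj_pair)
      have g: "g \<in> G" "s \<in> carrier S" "h \<in> G" "t \<in> carrier S" "act (\<gamma> g) s = act (\<gamma> h) t"
        using pq by (auto simp: presentation_kernel_def)
      \<comment> \<open>Rewritten over \<open>X\<close>, two words of equal value form a pair in the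
        kernel of \<open>\<beta>\<close>, and \<open>P\<close> relates their images over
        \<open>G\<close>.\<close>
      have "((w g, u g \<otimes> s), (w h, u h \<otimes> t)) \<in> presentation_kernel S act X \<beta>"
        using g wu \<beta>A by (simp add: presentation_kernel_def act_mult)
      then have "(\<phi> (w g, u g \<otimes> s), \<phi> (w h, u h \<otimes> t)) \<in> r'" using P by auto
      then have "((g, s), \<phi> (w h, u h \<otimes> t)) \<in> r'" using step g r''(2) by (meson transD)
      then show "(p, q) \<in> r'" using step[OF g(3,4)] r''(1,2) by (auto dest: symD transD)
    qed
  qed
  have "finite E" using G H(1) by (simp add: E_def)
  from con this EK minK show ?thesis by (rule fin_gen_congruenceI)
qed

section \<open>Multiplication in a monoid J-class\<close>

section \<open>Monoid J-classes\<close>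

locale J_class = monoid S for S :: "('s, 'm) monoid_scheme" (structure) +
  fixes J :: "'s set" and e :: 's
  assumes J_class: "monoid_J_class S J e"
begin

abbreviation T where "T \<equiv> S\<lparr>carrier := J, one := e\<rparr>"

lemma J_mult: "a \<in> J \<Longrightarrow> b \<in> J \<Longrightarrow> a \<otimes> b \<in> J"
  and e_J: "e \<in> J"
  and e_left: "a \<in> J \<Longrightarrow> e \<otimes> a = a"
  and e_right: "a \<in> J \<Longrightarrow> a \<otimes> e = a"
  using J_class by (auto simp: monoid_J_class_def)

text \<open>The class contains \<open>e\<close>, hence is the class of \<open>e\<close>. Membership
  in \<open>J\<close> thereby becomes an equality of principal ideals, provable by two
  inclusions.\<close>

lemma J_iff: "b \<in> J \<longleftrightarrow> b \<in> carrier S \<and> principal_ideal S b = principal_ideal S e"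
proof -
  obtain a where "J = green_J S `` {a}"
    using J_class by (auto simp: monoid_J_class_def elim!: quotientE)
  then show ?thesis using e_J by (auto simp: green_J_def)
qed

lemma J_carrier: "a \<in> J \<Longrightarrow> a \<in> carrier S"
  by (simp add: J_iff)

lemma e_carrier: "e \<in> carrier S"
  using e_J by (rule J_carrier)

lemma principal_ideal_mult:
  assumes "s \<in> carrier S" "a \<in> carrier S" "t \<in> carrier S"
  shows "principal_ideal S (s \<otimes> a \<otimes> t) \<subseteq> principal_ideal S a"
proof
  fix x assume "x \<in> principal_ideal S (s \<otimes> a \<otimes> t)"
  then obtain p q where "p \<in> carrier S" "q \<in> carrier S" "x = p \<otimes> (s \<otimes> a \<otimes> t) \<otimes> q"
    by (auto simp: principal_ideal_def)
  then have "x = (p \<otimes> s) \<otimes> a \<otimes> (t \<otimes> q)" "p \<otimes> s \<in> carrier S" "t \<otimes> q \<in> carrier S"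
    using assms by (auto simp: m_assoc)
  then show "x \<in> principal_ideal S a" unfolding principal_ideal_def by blast
qed

text \<open>If \<open>e \<otimes> s \<otimes> t\<close> lies in \<open>J\<close>, the principal
  ideal of \<open>e \<otimes> s\<close> is squeezed between those of
  \<open>e \<otimes> s \<otimes> t\<close> and \<open>e\<close>, which coincide; so
  \<open>e \<otimes> s\<close> lies in \<open>J\<close>. Then
  \<open>e \<otimes> s = e \<otimes> s \<otimes> e\<close> turns the product into
  \<open>(e \<otimes> s) \<otimes> (e \<otimes> t)\<close>, and the same comparison handles
  \<open>e \<otimes> t\<close>. Hence the \<open>s\<close> with \<open>e \<otimes> s \<in> J\<close>
  form a submonoid whose complement is an ideal, and left multiplication by \<open>e\<close> maps
  this submonoid homomorphically onto \<open>J\<close>.\<close>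

lemma e_mult_J:
  assumes s: "s \<in> carrier S" and t: "t \<in> carrier S"
  shows "e \<otimes> s \<otimes> t \<in> J \<longleftrightarrow> e \<otimes> s \<in> J \<and> e \<otimes> t \<in> J"
proof -
  have eq: "e \<otimes> s \<otimes> t = (e \<otimes> s) \<otimes> (e \<otimes> t)" if "e \<otimes> s \<in> J"
    using e_right[OF that] s t e_carrier by (metis m_assoc m_closed)
  have below: "principal_ideal S (e \<otimes> u) \<subseteq> principal_ideal S e" if "u \<in> carrier S" for u
    using principal_ideal_mult[of \<one> e u] that e_carrier by simp
  have es: "e \<otimes> s \<in> J" if "e \<otimes> s \<otimes> t \<in> J"
  proof -
    have "principal_ideal S e = principal_ideal S (\<one> \<otimes> (e \<otimes> s) \<otimes> t)"
      using that s t e_carrier by (simp add: J_iff)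
    also have "\<dots> \<subseteq> principal_ideal S (e \<otimes> s)"
      using s t e_carrier by (intro principal_ideal_mult) simp_all
    finally have "principal_ideal S (e \<otimes> s) = principal_ideal S e"
      using below[OF s] by (rule subset_antisym[rotated])
    then show ?thesis using s e_carrier by (simp add: J_iff)
  qed
  have et: "e \<otimes> t \<in> J" if est: "e \<otimes> s \<otimes> t \<in> J"
  proof -
    have "principal_ideal S e = principal_ideal S (e \<otimes> s \<otimes> t)"
      using est by (simp add: J_iff)
    also have "\<dots> = principal_ideal S ((e \<otimes> s) \<otimes> (e \<otimes> t) \<otimes> \<one>)"
      using eq[OF es[OF est]] s t e_carrier by simp
    also have "\<dots> \<subseteq> principal_ideal S (e \<otimes> t)"
      using s t e_carrier by (intro principal_ideal_mult) simp_all
    finally have "principal_ideal S (e \<otimes> t) = principal_ideal S e"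
      using below[OF t] by (rule subset_antisym[rotated])
    then show ?thesis using t e_carrier by (simp add: J_iff)
  qed
  show ?thesis
  proof
    assume "e \<otimes> s \<otimes> t \<in> J" then show "e \<otimes> s \<in> J \<and> e \<otimes> t \<in> J" using es et by blast
  next
    assume "e \<otimes> s \<in> J \<and> e \<otimes> t \<in> J"
    then show "e \<otimes> s \<otimes> t \<in> J" using eq J_mult by simp
  qed
qed

lemma mult_e_mult:
  assumes "a \<in> J" "s \<in> carrier S"
  shows "a \<otimes> (e \<otimes> s) = a \<otimes> s"
  using assms e_right[of a] by (metis J_carrier e_carrier m_assoc)

lemma mult_in_J_iff:
  assumes "a \<in> J" "s \<in> carrier S"
  shows "a \<otimes> s \<in> J \<longleftrightarrow> e \<otimes> s \<in> J"
  using e_mult_J[of a s] assms e_left[of a] J_carrier by auto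

section \<open>Congruences over \<open>J\<close> and over \<open>S\<close>\<close>

lemma monoid_T: "monoid T"
  by unfold_locales (auto simp: J_mult e_J e_left e_right m_assoc J_carrier)

lemma free_act_T: "free_act T = free_act S"
  by (auto simp: free_act_def fun_eq_iff)

text \<open>All \<open>(x, s)\<close> with \<open>e \<otimes> s \<notin> J\<close> form a single
  class, for all \<open>x\<close> together, like the subact collapsed in a Rees quotient. On
  \<open>X \<times> J\<close> the factor \<open>e\<close> changes nothing, so there the relation is
  \<open>r\<close>.\<close>

definition extend_rel :: "'x set \<Rightarrow> ('x \<times> 's) rel \<Rightarrow> ('x \<times> 's) rel" where
  "extend_rel X r = {(p, q). p \<in> X \<times> carrier S \<and> q \<in> X \<times> carrier S \<and>
     (e \<otimes> snd p \<in> J \<and> e \<otimes> snd q \<in> J \<and> ((fst p, e \<otimes> snd p), (fst q, e \<otimes> snd q)) \<in> r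
      \<or> e \<otimes> snd p \<notin> J \<and> e \<otimes> snd q \<notin> J)}"

text \<open>If \<open>e \<otimes> u \<notin> J\<close>, multiplication by \<open>u\<close> sends
  everything into the collapsed class. If \<open>e \<otimes> u \<in> J\<close>, that class is mapped
  into itself, and elsewhere \<open>e \<otimes> (s \<otimes> u) = (e \<otimes> s) \<otimes> (e
  \<otimes> u)\<close>, so \<open>u\<close> acts through an element of \<open>J\<close>, with which
  \<open>r\<close> is compatible.\<close>

lemma extend_rel_congruence:
  assumes r: "act_congruence T (X \<times> J) (free_act T) r"
  shows "act_congruence S (X \<times> carrier S) (free_act S) (extend_rel X r)"
proof -
  have r: "\<forall>a\<in>X \<times> J. (a, a) \<in> r" "sym r" "trans r"
    and cong: "\<forall>p q. \<forall>s\<in>J. (p, q) \<in> r \<longrightarrow> (free_act S p s, free_act S q s) \<in> r"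
    using r by (simp_all add: act_congruence_iff free_act_T)
  have rmult: "((x, a \<otimes> s), (y, b \<otimes> s)) \<in> r" if "s \<in> J" "((x, a), (y, b)) \<in> r" for x y a b s
    using bspec[OF spec[OF spec[OF cong, of "(x, a)"], of "(y, b)"] that(1)] that(2)
    by (simp add: free_act_def)
  have step: "((x, e \<otimes> (s \<otimes> u)), (y, e \<otimes> (t \<otimes> u))) \<in> r"
    if "s \<in> carrier S" "t \<in> carrier S" "u \<in> carrier S" "e \<otimes> s \<in> J" "e \<otimes> t \<in> J" "e \<otimes> u \<in> J"
      "((x, e \<otimes> s), (y, e \<otimes> t)) \<in> r" for x y s t u
    using rmult[OF that(6,7)] that mult_e_mult[of "e \<otimes> s" u] mult_e_mult[of "e \<otimes> t" u] e_carrier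
    by (simp add: m_assoc)
  have J: "e \<otimes> (s \<otimes> t) \<in> J \<longleftrightarrow> e \<otimes> s \<in> J \<and> e \<otimes> t \<in> J"
    if "s \<in> carrier S" "t \<in> carrier S" for s t
    using e_mult_J[OF that] that e_carrier by (simp add: m_assoc)
  show ?thesis
    unfolding act_congruence_iff
  proof (intro conjI)
    show "sym (extend_rel X r)"
      using r(2) by (auto simp: extend_rel_def intro!: symI dest: symD)
    show "trans (extend_rel X r)"
      using r(3) by (auto simp: extend_rel_def intro!: transI dest: transD)
  qed (use r(1) in \<open>auto simp: extend_rel_def free_act_def J step\<close>)
qed

lemma extend_rel_J:
  assumes "r \<subseteq> (X \<times> J) \<times> (X \<times> J)"
  shows "r \<subseteq> extend_rel X r"
proof (rule subrelI)
  fix p q assume pq: "(p, q) \<in> r"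
  then have "p \<in> X \<times> J" "q \<in> X \<times> J" using assms by auto
  then show "(p, q) \<in> extend_rel X r"
    using pq by (cases p; cases q) (simp add: extend_rel_def e_left J_carrier)
qed

text \<open>Extending \<open>r\<close> gives a congruence over \<open>S\<close> that contains
  \<open>H\<close>, hence \<open>R\<close>; restricting \<open>R\<close> to
  \<open>X \<times> J\<close> gives one over \<open>T\<close> that contains \<open>H\<close>, hence
  \<open>r\<close>. So the inclusion of free acts induces an injection of
  \<open>(X \<times> J) // r\<close> into \<open>(X \<times> carrier S) // R\<close>.\<close>

lemma generated_congruence_restrict:
  assumes r: "act_congruence T (X \<times> J) (free_act T) r" and "H \<subseteq> r"
    and minr: "\<And>r'. act_congruence T (X \<times> J) (free_act T) r' \<Longrightarrow> H \<subseteq> r' \<Longrightarrow> r \<subseteq> r'"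
    and R: "act_congruence S (X \<times> carrier S) (free_act S) R" and "H \<subseteq> R"
    and minR: "\<And>R'. act_congruence S (X \<times> carrier S) (free_act S) R' \<Longrightarrow> H \<subseteq> R' \<Longrightarrow> R \<subseteq> R'"
  shows "R \<subseteq> extend_rel X r" and "p \<in> X \<times> J \<Longrightarrow> q \<in> X \<times> J \<Longrightarrow> (p, q) \<in> R \<longleftrightarrow> (p, q) \<in> r"
proof -
  have rX: "r \<subseteq> (X \<times> J) \<times> (X \<times> J)" using r by (simp add: act_congruence_iff)
  show ext: "R \<subseteq> extend_rel X r"
    using minR[OF extend_rel_congruence[OF r]] extend_rel_J[OF rX] \<open>H \<subseteq> r\<close> by blast
  have "act_congruence T (X \<times> carrier S) (free_act S) R"
    using R J_carrier by (simp add: act_congruence_iff)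
  then have "act_congruence T (X \<times> J) (free_act T)
      {(p, q). p \<in> X \<times> J \<and> q \<in> X \<times> J \<and> (id p, id q) \<in> R}"
    by (rule act_congruence_pullback[where h = id]) (auto simp: J_carrier J_mult free_act_def)
  then have "r \<subseteq> {(p, q). p \<in> X \<times> J \<and> q \<in> X \<times> J \<and> (id p, id q) \<in> R}"
    using \<open>H \<subseteq> r\<close> rX \<open>H \<subseteq> R\<close> by (intro minr) auto
  then show "(p, q) \<in> R \<longleftrightarrow> (p, q) \<in> r" if "p \<in> X \<times> J" "q \<in> X \<times> J"
    using that ext e_left by (auto simp: extend_rel_def)
qed

text \<open>Generators are obtained from those pairs of a finite generating set \<open>H\<close> of
  \<open>K\<close> that lie over \<open>J\<close>, multiplied by \<open>e\<close>. If
  \<open>r'\<close> contains them, \<open>extend_rel G r'\<close> contains all of \<open>H\<close>: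
  the remaining pairs have both entries in the collapsed class. Minimality of \<open>K\<close> puts
  \<open>K\<close> inside this extension, whose restriction to \<open>G \<times> J\<close> is
  \<open>r'\<close>.\<close>

lemma fin_gen_congruence_restrict:
  assumes fg: "fin_gen_congruence S (G \<times> carrier S) (free_act S) K"
    and K: "act_congruence T (G \<times> J) (free_act T) (K \<inter> (G \<times> J) \<times> (G \<times> J))"
    and J: "\<And>g s h t. ((g, s), (h, t)) \<in> K \<Longrightarrow> e \<otimes> s \<in> J \<longleftrightarrow> e \<otimes> t \<in> J"
    and eK: "\<And>g s h t. ((g, s), (h, t)) \<in> K \<Longrightarrow> e \<otimes> s \<in> J \<Longrightarrow> ((g, e \<otimes> s), (h, e \<otimes> t)) \<in> K"
  shows "fin_gen_congruence T (G \<times> J) (free_act T) (K \<inter> (G \<times> J) \<times> (G \<times> J))"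
proof -
  have KG: "K \<subseteq> (G \<times> carrier S) \<times> (G \<times> carrier S)"
    using fg by (auto simp: fin_gen_congruence_def act_congruence_iff)
  obtain H where H: "finite H" "H \<subseteq> K"
    and min: "\<And>r'. act_congruence S (G \<times> carrier S) (free_act S) r' \<Longrightarrow> H \<subseteq> r' \<Longrightarrow> K \<subseteq> r'"
    using fg by (auto simp: fin_gen_congruence_def)
  let ?\<pi> = "\<lambda>p. (fst p, e \<otimes> snd p)"
  \<comment> \<open>Testing the first entry suffices, since assumption \<open>J\<close> transfers
    the test to the second.\<close>
  define E where "E = map_prod ?\<pi> ?\<pi> ` {(p, q) \<in> H. e \<otimes> snd p \<in> J}"
  have "finite {(p, q) \<in> H. e \<otimes> snd p \<in> J}" using H(1) by (rule finite_subset[rotated]) auto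
  then have finE: "finite E" by (simp add: E_def)
  have EK: "E \<subseteq> K \<inter> (G \<times> J) \<times> (G \<times> J)"
  proof
    fix z assume "z \<in> E"
    then obtain g s h t where z: "((g, s), (h, t)) \<in> H" "e \<otimes> s \<in> J" "z = ((g, e \<otimes> s), (h, e \<otimes> t))"
      by (auto simp: E_def)
    then have "((g, s), (h, t)) \<in> K" using H(2) by blast
    then show "z \<in> K \<inter> (G \<times> J) \<times> (G \<times> J)" using z J eK KG by auto
  qed
  have minK: "K \<inter> (G \<times> J) \<times> (G \<times> J) \<subseteq> r'"
    if r': "act_congruence T (G \<times> J) (free_act T) r'" and E: "E \<subseteq> r'" for r'
  proof -
    have "H \<subseteq> extend_rel G r'"
    proof (rule subrelI)
      fix p q assume pq: "(p, q) \<in> H"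
      obtain g s h t where [simp]: "p = (g, s)" "q = (h, t)" by (metis surj_pair)
      have K': "((g, s), (h, t)) \<in> K" using pq H(2) by auto
      have "((g, e \<otimes> s), (h, e \<otimes> t)) \<in> r'" if "e \<otimes> s \<in> J"
        using E pq that by (force simp: E_def)
      then show "(p, q) \<in> extend_rel G r'" using J[OF K'] K' KG by (auto simp: extend_rel_def)
    qed
    then have "K \<subseteq> extend_rel G r'" by (intro min extend_rel_congruence r')
    then show ?thesis using e_left by (auto simp: extend_rel_def)
  qed
  from K finE EK minK show ?thesis by (rule fin_gen_congruenceI)
qed

section \<open>Passing right coherence from \<open>S\<close> to \<open>J\<close>\<close>

lemma right_coherent_T:
  assumes S: "right_coherent S"
  shows "right_coherent T"
  unfolding right_coherent_def
proof (intro conjI allI impI monoid_T)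
  fix A :: "(nat \<times> 's) set set" and act B
  assume "fin_presented_act T A act \<and> subact T B A act \<and> fin_gen_act T B act"
  then have fp: "fin_presented_act T A act" and sub: "subact T B A act" and fgB: "fin_gen_act T B act"
    by simp_all
  interpret A: right_act T A act using fp by (simp add: fin_presented_act_def)
  obtain X :: "nat set" and \<alpha> where X: "finite X" and genA: "generates T A act X \<alpha>"
    and kerT: "fin_gen_congruence T (X \<times> carrier T) (free_act T) (presentation_kernel T act X \<alpha>)"
    using fp by (rule fin_presented_act_kernel)
  let ?r = "presentation_kernel T act X \<alpha>"
  have ker: "fin_gen_congruence T (X \<times> J) (free_act T) ?r" using kerT by simp
  have r: "act_congruence T (X \<times> J) (free_act T) ?r"
    using ker by (simp add: fin_gen_congruence_def)
  obtain H where H: "finite H" "H \<subseteq> ?r"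
    and minr: "\<And>r'. act_congruence T (X \<times> J) (free_act T) r' \<Longrightarrow> H \<subseteq> r' \<Longrightarrow> ?r \<subseteq> r'"
    using ker by (auto simp: fin_gen_congruence_def)
  have actS: "right_act S (X \<times> carrier S) (free_act S)"
    by (rule free_right_act) (rule monoid_axioms)
  have "?r \<subseteq> (X \<times> carrier S) \<times> (X \<times> carrier S)"
    using J_carrier by (auto simp: presentation_kernel_def)
  with H(2) have HX: "H \<subseteq> (X \<times> carrier S) \<times> (X \<times> carrier S)" by (rule subset_trans)
  \<comment> \<open>The defining relations \<open>H\<close> of \<open>A\<close> are now imposed on
    the free act over \<open>S\<close>.\<close>
  obtain R where fgR: "fin_gen_congruence S (X \<times> carrier S) (free_act S) R" and "H \<subseteq> R"
    and minR: "\<And>R'. act_congruence S (X \<times> carrier S) (free_act S) R' \<Longrightarrow> H \<subseteq> R' \<Longrightarrow> R \<subseteq> R'"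
    by (rule fin_gen_congruence_generated[OF actS H(1) HX], rule that)
  have R: "act_congruence S (X \<times> carrier S) (free_act S) R"
    using fgR by (simp add: fin_gen_congruence_def)
  have eqv: "equiv (X \<times> carrier S) R" using R by (simp add: act_congruence_def)
  note restr = generated_congruence_restrict[OF r H(2) minr R \<open>H \<subseteq> R\<close> minR]
  let ?N = "(X \<times> carrier S) // R" and ?n = "quot_act (free_act S) R"
  have N: "right_act S ?N ?n" by (rule quot_right_act[OF actS R])
  interpret N: right_act S ?N ?n by fact
  have "act_iso S ?N ?n ?N ?n id" by (simp add: act_iso_def)
  then have fpN: "fin_presented_act S ?N ?n" by (rule fin_presented_actI[OF N X fgR])

  obtain G where G: "finite G" "G \<subseteq> B" "B = (\<Union>a\<in>G. {act a s | s. s \<in> carrier T})"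
    using fgB unfolding fin_gen_act_def by (elim exE conjE) (rule that)
  have BA: "B \<subseteq> A" using sub by (simp add: subact_def)
  have "\<forall>g\<in>G. \<exists>x a. x \<in> X \<and> a \<in> J \<and> g = act (\<alpha> x) a"
  proof
    fix g assume "g \<in> G"
    then have "g \<in> A" using G(2) BA by blast
    then have "\<exists>x\<in>X. \<exists>a\<in>carrier T. g = act (\<alpha> x) a" using genA unfolding generates_def by blast
    then show "\<exists>x a. x \<in> X \<and> a \<in> J \<and> g = act (\<alpha> x) a" by auto
  qed
  \<comment> \<open>\<open>(w g, u g)\<close> is a word over \<open>X\<close> for the generator
    \<open>g\<close> of \<open>B\<close>; as \<open>u g\<close> lies in \<open>J\<close>, the word
    also belongs to the free act over \<open>S\<close>.\<close>
  then obtain w u where wu: "\<And>g. g \<in> G \<Longrightarrow> w g \<in> X" "\<And>g. g \<in> G \<Longrightarrow> u g \<in> J"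
      "\<And>g. g \<in> G \<Longrightarrow> g = act (\<alpha> (w g)) (u g)"
    by metis
  have uS: "u g \<in> carrier S" if "g \<in> G" for g using wu(2)[OF that] by (rule J_carrier)
  define \<gamma> where "\<gamma> g = R `` {(w g, u g)}" for g
  have \<gamma>N: "\<gamma> g \<in> ?N" if "g \<in> G" for g using wu uS that by (auto simp: \<gamma>_def intro!: quotientI)
  have n\<gamma>: "?n (\<gamma> g) s = R `` {(w g, u g \<otimes> s)}" if "g \<in> G" "s \<in> carrier S" for g s
    using that wu uS by (simp add: \<gamma>_def quot_act_class[OF R] free_act_def)
  \<comment> \<open>The subact over \<open>S\<close> generated by the same words, read in the
    quotient \<open>?N\<close>. It shares the index set \<open>G\<close> with \<open>B\<close>, so
    its kernel \<open>?K\<close> can be compared with the kernel \<open>?L\<close> of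
    \<open>B\<close>.\<close>
  define C where "C = (\<Union>g\<in>G. {?n (\<gamma> g) s | s. s \<in> carrier S})"
  have CN: "C \<subseteq> ?N" using \<gamma>N by (auto simp: C_def N.act_closed)
  have Ccl: "?n c t \<in> C" if c: "c \<in> C" and t: "t \<in> carrier S" for c t
  proof -
    obtain g s where g: "g \<in> G" "s \<in> carrier S" "c = ?n (\<gamma> g) s"
      using c unfolding C_def by blast
    then have "?n c t = ?n (\<gamma> g) (s \<otimes> t)" using t \<gamma>N by (simp add: N.act_mult)
    then show ?thesis using g(1) m_closed[OF g(2) t] unfolding C_def by blast
  qed
  have \<gamma>C: "\<gamma> g \<in> C" if "g \<in> G" for g
    using that N.act_one[OF \<gamma>N[OF that]] unfolding C_def by force
  have subC: "subact S C ?N ?n" using CN Ccl by (simp add: subact_def)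
  have "fin_gen_act S C ?n"
    unfolding fin_gen_act_def
    by (rule exI[of _ "\<gamma> ` G"]) (use G(1) \<gamma>C in \<open>auto simp: C_def\<close>)
  then have fpC: "fin_presented_act S C ?n"
    using right_coherent_act[OF S fpN subC] by blast
  have genC: "generates S C ?n G \<gamma>"
    using \<gamma>C by (auto simp: generates_def C_def)
  let ?K = "presentation_kernel S ?n G \<gamma>"
  have fgK: "fin_gen_congruence S (G \<times> carrier S) (free_act S) ?K"
    by (rule fin_gen_presentation_kernel[OF fpC G(1) genC])
  have K_iff: "((g, s), (h, t)) \<in> ?K \<longleftrightarrow> g \<in> G \<and> h \<in> G \<and> s \<in> carrier S \<and> t \<in> carrier S
      \<and> ((w g, u g \<otimes> s), (w h, u h \<otimes> t)) \<in> R" for g s h t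
  proof (cases "g \<in> G \<and> h \<in> G \<and> s \<in> carrier S \<and> t \<in> carrier S")
    case True
    then have "(R `` {(w g, u g \<otimes> s)} = R `` {(w h, u h \<otimes> t)})
        = (((w g, u g \<otimes> s), (w h, u h \<otimes> t)) \<in> R)"
      using wu(1) uS by (intro eq_equiv_class_iff[OF eqv]) auto
    then show ?thesis using True by (simp add: presentation_kernel_def n\<gamma>)
  qed (auto simp: presentation_kernel_def)

  have actB: "right_act T B act"
    by (rule right_act.intro[OF monoid_T], unfold_locales)
      (use sub BA A.act_one A.act_mult in \<open>auto simp: subact_def\<close>)
  have genB: "generates T B act G id"
    unfolding generates_def
  proof (intro conjI ballI)
    fix b assume "b \<in> B"
    then show "\<exists>g\<in>G. \<exists>s\<in>carrier T. b = act (id g) s" by (subst (asm) G(3)) auto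
  qed (use G(2) in auto)
  let ?L = "presentation_kernel T act G id"
  \<comment> \<open>Equality in \<open>A\<close> of two words with entries in \<open>J\<close> is
    membership in \<open>?r\<close>, which agrees with \<open>R\<close> on
    \<open>X \<times> J\<close>.\<close>
  have L: "?L = ?K \<inter> (G \<times> J) \<times> (G \<times> J)"
  proof -
    have "((g, s), (h, t)) \<in> ?L \<longleftrightarrow> ((g, s), (h, t)) \<in> ?K"
      if st: "g \<in> G" "s \<in> J" "h \<in> G" "t \<in> J" for g s h t
    proof -
      have act: "act g' s' = act (\<alpha> (w g')) (u g' \<otimes> s')" if "g' \<in> G" "s' \<in> J" for g' s'
      proof -
        have "\<alpha> (w g') \<in> A" using genA wu(1)[OF that(1)] by (auto simp: generates_def)
        then show ?thesis using A.act_mult[of "\<alpha> (w g')" "u g'" s'] wu that by simp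
      qed
      have "((g, s), (h, t)) \<in> ?L \<longleftrightarrow> ((w g, u g \<otimes> s), (w h, u h \<otimes> t)) \<in> ?r"
        using st wu J_mult act[of g s] act[of h t] by (simp add: presentation_kernel_def)
      also have "\<dots> \<longleftrightarrow> ((w g, u g \<otimes> s), (w h, u h \<otimes> t)) \<in> R"
        using st wu J_mult by (intro restr(2)[symmetric]) auto
      finally show ?thesis using st J_carrier by (simp add: K_iff)
    qed
    moreover have "?L \<subseteq> (G \<times> J) \<times> (G \<times> J)" by (auto simp: presentation_kernel_def)
    ultimately show ?thesis by auto
  qed
  have "fin_gen_congruence T (G \<times> J) (free_act T) (?K \<inter> (G \<times> J) \<times> (G \<times> J))"
  proof (rule fin_gen_congruence_restrict[OF fgK])
    show "act_congruence T (G \<times> J) (free_act T) (?K \<inter> (G \<times> J) \<times> (G \<times> J))"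
      using presentation_kernel_congruence[OF actB, of id G] G(2) by (simp add: L)
    fix g s h t assume K: "((g, s), (h, t)) \<in> ?K"
    then have gh: "g \<in> G" "h \<in> G" "s \<in> carrier S" "t \<in> carrier S"
      and inR: "((w g, u g \<otimes> s), (w h, u h \<otimes> t)) \<in> R" by (auto simp: K_iff)
    \<comment> \<open>\<open>extend_rel\<close> tests the products \<open>u g' \<otimes> s'\<close>;
      as \<open>u g'\<close> lies in \<open>J\<close>, the outcome depends on \<open>s'\<close>
      alone.\<close>
    have "e \<otimes> (u g' \<otimes> s') \<in> J \<longleftrightarrow> e \<otimes> s' \<in> J" if "g' \<in> G" "s' \<in> carrier S" for g' s'
      using that wu e_left uS e_carrier mult_in_J_iff by (metis m_assoc)
    then show "e \<otimes> s \<in> J \<longleftrightarrow> e \<otimes> t \<in> J"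
      using inR gh subsetD[OF restr(1) inR] by (auto simp: extend_rel_def)
    \<comment> \<open>Since \<open>u g\<close> lies in \<open>J\<close>,
      \<open>u g \<otimes> (e \<otimes> s) = u g \<otimes> s\<close>, and likewise for
      \<open>h\<close> and \<open>t\<close>, so the same pair of \<open>R\<close> is
      concerned.\<close>
    show "((g, e \<otimes> s), (h, e \<otimes> t)) \<in> ?K"
      using gh inR wu e_carrier by (simp add: K_iff mult_e_mult)
  qed
  then have "fin_gen_congruence T (G \<times> carrier T) (free_act T) ?L" by (simp add: L)
  then show "fin_presented_act T B act"
    by (rule fin_presented_act_of_kernel[OF actB G(1) genB])
qed

end

theorem theorem4p8:
  fixes S :: "('s, 'm) monoid_scheme" and J :: "'s set" and e :: 's
  assumes "right_coherent S"
    and "monoid_J_class S J e"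
  shows "right_coherent (S\<lparr>carrier := J, one := e\<rparr>)"
proof -
  interpret J_class S J e
    using assms by (simp add: J_class_def J_class_axioms_def right_coherent_def)
  show ?thesis using assms(1) by (rule right_coherent_T)
qed

end
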